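(* Let $G,J,K,L,M,N,P,Q,R,S$ be complex numbers and put $$\begin{aligned} A&=-G-J-M+2N-P-Q-3S+6,\\ B&=-2G-K-2M-2N-5P-2Q-6R-12S+30,\\ E&=G+J+M-N+2P+2Q+3R+6S-15,\\ F&=-3G-J-3K-7M-12P-3Q-6R-27S+60,\\ H&=-L-2N-P-Q-4R-3S+10,\\ I&=-G-J-2L-M-2P-3Q-6R-7S+20, \end{aligned}$$ and assume $B\ne0$. Then for all integers $m\ge0$ and $n\ge1$, $$\begin{aligned} B\,t_{3,m}^{(n)}&=\frac1{(A_1^{(n)})^5}\sum_{k_1+\cdots+k_5=m}\binom{m}{k_1,\dots,k_5}U_{k_1}^{(n)}\cdots U_{k_5}^{(n)}\\ &\quad-\frac{A}{A_1^{(5n)}}5^mU_m^{(5n)}-\frac{E}{A_1^{(4n)}A_1^{(n)}}\sum_{k=0}^m\binom mk4^{m-k}U_{m-k}^{(4n)}U_k^{(n)}-F\left(\frac{-1}{563}\right)^n\sum_{k=0}^m\binom mkU_k^{(n)}\\ &\quad-\frac{G}{A_1^{(n)}}\sum_{k=0}^m\binom mkt_{2,k}^{(n)}U_{m-k}^{(n)}-\frac{H}{A_1^{(3n)}A_1^{(2n)}}\sum_{k=0}^m\binom mk3^{m-k}2^kU_{m-k}^{(3n)}U_k^{(2n)}\\ &\quad-\frac{I}{A_1^{(3n)}}\sum_{k=0}^m\binom mk3^kU_k^{(3n)}t_{1,m-k}^{(n)}\\ &\quad-\frac{J}{A_2^{(n)}A_1^{(2n)}}\sum_{k_1+k_2+k_3=m}\binom{m}{k_1,k_2,k_3}(-1)^{k_1}V_{k_1}^{(n)}2^{k_2}U_{k_2}^{(2n)}\\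 &\quad-\frac{K}{A_2^{(n)}}\sum_{k_1+k_2+k_3=m}\binom{m}{k_1,k_2,k_3}(-1)^{k_1}V_{k_1}^{(n)}t_{1,k_2}^{(n)}\\ &\quad-\frac{L}{A_1^{(3n)}(A_1^{(n)})^2}\sum_{k_1+k_2+k_3=m}\binom{m}{k_1,k_2,k_3}3^{k_1}U_{k_1}^{(3n)}U_{k_2}^{(n)}U_{k_3}^{(n)}\\ &\quad-\frac{M}{A_2^{(n)}(A_1^{(n)})^2}\sum_{k_1+k_2+k_3+k_4=m}\binom{m}{k_1,k_2,k_3,k_4}(-1)^{k_1}V_{k_1}^{(n)}U_{k_2}^{(n)}U_{k_3}^{(n)}\\ &\quad-\frac{N}{(A_1^{(2n)})^2A_1^{(n)}}\sum_{k_1+k_2+k_3=m}\binom{m}{k_1,k_2,k_3}2^{k_1}U_{k_1}^{(2n)}2^{k_2}U_{k_2}^{(2n)}U_{k_3}^{(n)}\\ &\quad-\frac{P}{A_1^{(n)}}\sum_{k_1+k_2+k_3=m}\binom{m}{k_1,k_2,k_3}t_{1,k_1}^{(n)}t_{1,k_2}^{(n)}U_{k_3}^{(n)}\\ &\quad-\frac{Q}{A_1^{(2n)}A_1^{(n)}}\sum_{k_1+k_2+k_3=m}\binom{m}{k_1,k_2,k_3}2^{k_1}U_{k_1}^{(2n)}t_{1,k_2}^{(n)}U_{k_3}^{(n)}\\ &\quad-\frac{R}{A_1^{(2n)}(A_1^{(n)})^3}\sum_{k_1+k_2+k_3+k_4=m}\binom{m}{k_1,k_2,k_3,k_4}2^{k_1}U_{k_1}^{(2n)}U_{k_2}^{(n)}U_{k_3}^{(n)}U_{k_4}^{(n)}\\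 &\quad-\frac{S}{(A_1^{(n)})^3}\sum_{k_1+k_2+k_3+k_4=m}\binom{m}{k_1,k_2,k_3,k_4}t_{1,k_1}^{(n)}U_{k_2}^{(n)}U_{k_3}^{(n)}U_{k_4}^{(n)}. \end{aligned}$$
   Context: Let $\lambda_1,\lambda_2,\lambda_3,\lambda_4$ be the (distinct, complex) roots of $x^4-x^3-x^2-x-1=0$ and $c_i=\frac1{-\lambda_i^3+6\lambda_i-1}$. A Tetranacci-type sequence is one in which, from index $4$ on, each term is the sum of the four preceding terms. For each $n\ge1$, let $A_1^{(n)}$ be the nonzero rational number and $U_k^{(n)}=T_{1,k}^{(s_{1,0}^{(n)},s_{1,1}^{(n)},s_{1,2}^{(n)},s_{1,3}^{(n)})}$ the Tetranacci-type sequence with integer initial values $U_j^{(n)}=s_{1,j}^{(n)}$ ($0\le j\le3$) of greatest common divisor $1$ such that $$\sum_{i=1}^4c_i^ne^{\lambda_ix}=\frac1{A_1^{(n)}}\sum_{k=0}^\infty U_k^{(n)}\frac{x^k}{k!}.$$ Likewise let $A_2^{(n)}$ be the nonzero rational number and $V_k^{(n)}=T_{2,k}^{(s_{2,0}^{(n)},s_{2,1}^{(n)},s_{2,2}^{(n)},s_{2,3}^{(n)})}$ the Tetranacci-type sequence with integer initial values $V_j^{(n)}=s_{2,j}^{(n)}$ ($0\le j\le3$) of greatest common divisor $1$ such that $$\sum_{i=1}^4\Big(\prod_{j\ne i}c_j^n\Big)e^{\lambda_ix}=\frac1{A_2^{(n)}}\sum_{k=0}^\infty V_k^{(n)}\frac{x^k}{k!}.$$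 The signs are fixed by requiring $U_k^{(n)}>0$ and $V_k^{(n)}>0$ for all sufficiently large $k$. Put $$t_{1,m}^{(n)}=\frac12\left(\frac1{(A_1^{(n)})^2}\sum_{k=0}^m\binom mkU_k^{(n)}U_{m-k}^{(n)}-\frac{2^m}{A_1^{(2n)}}U_m^{(2n)}\right),$$ equivalently $\sum_{m\ge0}t_{1,m}^{(n)}\frac{x^m}{m!}=\sum_{1\le i<j\le4}c_i^nc_j^ne^{(\lambda_i+\lambda_j)x}$, and define $t_{2,m}^{(n)}$, $t_{3,m}^{(n)}$ by $$\sum_{m=0}^\infty t_{2,m}^{(n)}\frac{x^m}{m!}=\sum_{1\le i<j<l\le4}c_i^nc_j^nc_l^ne^{(\lambda_i+\lambda_j+\lambda_l)x}\left(c_i^ne^{\lambda_ix}+c_j^ne^{\lambda_jx}+c_l^ne^{\lambda_lx}\right),$$ $$\sum_{m=0}^\infty t_{3,m}^{(n)}\frac{x^m}{m!}=\sum_{1\le i<j<l\le4}c_i^nc_j^nc_l^ne^{(\lambda_i+\lambda_j+\lambda_l)x}\left(c_i^nc_j^ne^{(\lambda_i+\lambda_j)x}+c_j^nc_l^ne^{(\lambda_j+\lambda_l)x}+c_l^nc_i^ne^{(\lambda_l+\lambda_i)x}\right).$$ Superscripts $(n)$ are indices; $c_i^n$ is an $n$-th power. All indices $k_i$ run over nonnegative integers and $\binom{m}{k_1,\dots,k_r}=\frac{m!}{k_1!\cdots k_r!}$.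
   Formalization: The F-term is taken with the factor 1/A_1^(n), i.e. (F/A_1^(n))(-1/563)^n Σ binom(m,k) U_k^(n); as printed without it the identity fails, e.g. for n=2, m=0 and G=...=S=0, where A_1^(2)=563, U_0^(2)=40, F=60. *)

theory Defs
  imports Complex_Main "HOL-Computational_Algebra.Formal_Power_Series"
begin

unbundle fps_syntax

definition tetranacci_roots :: "(nat \<Rightarrow> complex) \<Rightarrow> bool" where
  "tetranacci_roots lam \<longleftrightarrow>
     bij_betw lam {1..4} {z. z ^ 4 - z ^ 3 - z ^ 2 - z - 1 = 0}"

definition coef :: "(nat \<Rightarrow> complex) \<Rightarrow> nat \<Rightarrow> complex" where
  "coef lam i = 1 / (- (lam i ^ 3) + 6 * lam i - 1)"

definition tetranacci_type :: "(nat \<Rightarrow> int) \<Rightarrow> bool" where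
  "tetranacci_type s \<longleftrightarrow>
     (\<forall>k\<ge>4. s k = s (k - 1) + s (k - 2) + s (k - 3) + s (k - 4))"

(* Identities between exponential generating functions are identities of formal power
   series over the complex numbers; the function exp (c x) is the series fps_exp c. *)

definition egf :: "(nat \<Rightarrow> complex) \<Rightarrow> complex fps" where
  "egf f = Abs_fps (\<lambda>k. f k / fact k)"

(* The scaling is unique: coprimality of the initial values determines (A, U) up to a common
   sign, and eventual positivity of U determines the sign. *)

definition normalized_egf :: "complex fps \<Rightarrow> rat \<Rightarrow> (nat \<Rightarrow> int) \<Rightarrow> bool" where
  "normalized_egf f A U \<longleftrightarrow>
     A \<noteq> 0 \<and> tetranacci_type U \<and> Gcd {U 0, U 1, U 2, U 3} = 1 \<and>
     f = fps_const (1 / of_rat A) * egf (\<lambda>k. of_int (U k)) \<and>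
     (\<forall>\<^sub>F k in sequentially. U k > 0)"

(* Since the sum of c_i^r exp (lambda_i x) is 1 / A1^(r) times the generating function of U^(r),
   every factor U^(r) in an identity between these series brings a factor 1 / A1^(r).  The term
   with coefficient F is the expansion of (c_1 c_2 c_3 c_4)^n exp x times that sum, so its
   factor is F / A1^(n); the source prints this term without 1 / A1^(n), and without it the
   identity fails, for example for n = 2, m = 0 and vanishing parameters, where A1^(2) = 563,
   U_0^(2) = 40 and F = 60. *)

definition gf1 :: "(nat \<Rightarrow> complex) \<Rightarrow> nat \<Rightarrow> complex fps" where
  "gf1 lam n = (\<Sum>i\<in>{1..4}. fps_const (coef lam i ^ n) * fps_exp (lam i))"

definition gf2 :: "(nat \<Rightarrow> complex) \<Rightarrow> nat \<Rightarrow> complex fps" where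
  "gf2 lam n =
     (\<Sum>i\<in>{1..4}. fps_const (\<Prod>j\<in>{1..4} - {i}. coef lam j ^ n) * fps_exp (lam i))"

definition t1 :: "(nat \<Rightarrow> rat) \<Rightarrow> (nat \<Rightarrow> nat \<Rightarrow> int) \<Rightarrow> nat \<Rightarrow> nat \<Rightarrow> complex" where
  "t1 A1 U n m =
     1 / 2 * (1 / (of_rat (A1 n)) ^ 2
                * (\<Sum>k=0..m. of_nat (m choose k) * of_int (U n k) * of_int (U n (m - k)))
              - 2 ^ m / of_rat (A1 (2 * n)) * of_int (U (2 * n) m))"

definition t2_gf :: "(nat \<Rightarrow> complex) \<Rightarrow> nat \<Rightarrow> complex fps" where
  "t2_gf lam n =
     (\<Sum>(i, j, l)\<in>{(i, j, l). 1 \<le> i \<and> i < j \<and> j < l \<and> l \<le> 4}.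
        fps_const (coef lam i ^ n * coef lam j ^ n * coef lam l ^ n)
        * fps_exp (lam i + lam j + lam l)
        * (fps_const (coef lam i ^ n) * fps_exp (lam i)
           + fps_const (coef lam j ^ n) * fps_exp (lam j)
           + fps_const (coef lam l ^ n) * fps_exp (lam l)))"

definition t3_gf :: "(nat \<Rightarrow> complex) \<Rightarrow> nat \<Rightarrow> complex fps" where
  "t3_gf lam n =
     (\<Sum>(i, j, l)\<in>{(i, j, l). 1 \<le> i \<and> i < j \<and> j < l \<and> l \<le> 4}.
        fps_const (coef lam i ^ n * coef lam j ^ n * coef lam l ^ n)
        * fps_exp (lam i + lam j + lam l)
        * (fps_const (coef lam i ^ n * coef lam j ^ n) * fps_exp (lam i + lam j)
           + fps_const (coef lam j ^ n * coef lam l ^ n) * fps_exp (lam j + lam l)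
           + fps_const (coef lam l ^ n * coef lam i ^ n) * fps_exp (lam l + lam i)))"

definition t2 :: "(nat \<Rightarrow> complex) \<Rightarrow> nat \<Rightarrow> nat \<Rightarrow> complex" where
  "t2 lam n m = fact m * t2_gf lam n $ m"

definition t3 :: "(nat \<Rightarrow> complex) \<Rightarrow> nat \<Rightarrow> nat \<Rightarrow> complex" where
  "t3 lam n m = fact m * t3_gf lam n $ m"

lemma egf_t2: "egf (t2 lam n) = t2_gf lam n"
  by (simp add: egf_def t2_def fps_eq_iff)

lemma egf_t3: "egf (t3 lam n) = t3_gf lam n"
  by (simp add: egf_def t3_def fps_eq_iff)

definition multinomial :: "nat \<Rightarrow> nat list \<Rightarrow> complex" where
  "multinomial m ks = fact m / prod_list (map fact ks)"

end

theory Submission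
  imports Defs
begin

text \<open>
  Write \<open>y\<^sub>i = c\<^sub>i^n exp (\<lambda>\<^sub>i x)\<close>.  Every sum in the claimed formula is a coefficient of an
  exponential generating function that is a symmetric polynomial in \<open>y\<^sub>1, \<dots>, y\<^sub>4\<close>, because
  binomial and multinomial convolutions are products of such series.  Since
  \<open>y\<^sub>i^r = c\<^sub>i^(rn) exp (r \<lambda>\<^sub>i x)\<close>, the numbers \<open>r^k U\<^sub>k\<close> of index \<open>rn\<close>, divided by \<open>A\<^sub>1\<close>, belong
  to the power sum \<open>p\<^sub>r\<close>; the numbers \<open>t\<^sub>1\<close> belong to the elementary symmetric polynomial
  \<open>e\<^sub>2 = (p\<^sub>1^2 - p\<^sub>2) / 2\<close>.  The arithmetic of the Tetranacci polynomial enters in only two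
  places.  The sum of its roots is 1, so a product of three of the \<open>y\<^sub>i\<close> is a constant times
  \<open>exp x\<close> divided by the remaining exponential; hence the generating function
  of \<open>(-1)^k V\<^sub>k / A\<^sub>2\<close>, multiplied by \<open>exp x\<close>, is \<open>e\<^sub>3\<close>.  The product of the \<open>c\<^sub>i\<close> is \<open>-1/563\<close>, so
  \<open>e\<^sub>4 = (-1/563)^n exp x\<close>.

  What remains is a polynomial identity.  The symmetric quintic forms in four variables are a
  vector space of dimension 6, with a basis of monomial symmetric functions
  \<open>m\<^sub>5, m\<^sub>4\<^sub>1, m\<^sub>3\<^sub>2, m\<^sub>3\<^sub>1\<^sub>1, m\<^sub>2\<^sub>2\<^sub>1, m\<^sub>2\<^sub>1\<^sub>1\<^sub>1\<close>.  The six forms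
  \<open>p\<^sub>5\<close>, \<open>p\<^sub>4 p\<^sub>1\<close>, \<open>p\<^sub>3 p\<^sub>2\<close>, \<open>p\<^sub>3 e\<^sub>2\<close>, \<open>m\<^sub>2\<^sub>2\<^sub>1\<close> (the generating function of \<open>t\<^sub>3\<close>) and \<open>e\<^sub>4 p\<^sub>1\<close>
  are again a basis, triangular over the first one.  Prescribing the multiples
  \<open>G, J, K, L, M, N, P, Q, R, S\<close> of the ten other products and expanding what is left of \<open>p\<^sub>1^5\<close> in
  this basis gives the coefficients \<open>A, E, H, I, B, F\<close>.  The identity is checked in
  \<open>quintic_expansion\<close> after Newton's identities have rewritten all forms in
  \<open>e\<^sub>1, e\<^sub>2, e\<^sub>3, e\<^sub>4\<close>.
\<close>

section \<open>The roots and the coefficients\<close>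

text \<open>The divided differences of \<open>x^4 - x^3 - x^2 - x - 1\<close> at two, three and four distinct roots vanish.  The last
  one is the sum of the roots minus 1, and the lower ones then determine the other elementary
  symmetric functions.  These are grouped by the pairs \<open>{a, b}\<close> and \<open>{c, d}\<close>, the form in which
  the next lemma eliminates the roots.\<close>

lemma vieta:
  fixes a b c d :: complex
  assumes d: "a \<noteq> b" "a \<noteq> c" "a \<noteq> d" "b \<noteq> c" "b \<noteq> d" "c \<noteq> d"
   and r: "a^4 - a^3 - a^2 - a - 1 = 0" "b^4 - b^3 - b^2 - b - 1 = 0"
          "c^4 - c^3 - c^2 - c - 1 = 0" "d^4 - d^3 - d^2 - d - 1 = 0"
  shows "a + b + c + d = 1" "a*b + c*d + (a+b)*(c+d) = -1"
    "a*b*(c+d) + c*d*(a+b) = 1" "a*b*(c*d) = -1"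
proof -
  have d1: "x^3 + x^2*y + x*y^2 + y^3 - (x^2 + x*y + y^2) - (x+y) - 1 = 0"
    if "x \<noteq> y" "x^4 - x^3 - x^2 - x - 1 = 0" "y^4 - y^3 - y^2 - y - 1 = 0" for x y :: complex
  proof -
    have "(x-y) * (x^3 + x^2*y + x*y^2 + y^3 - (x^2 + x*y + y^2) - (x+y) - 1) = 0"
      using that(2,3) by algebra
    then show ?thesis using that(1) by simp
  qed
  have d2: "x^2 + y^2 + z^2 + x*y + x*z + y*z - (x+y+z) - 1 = 0"
    if "x \<noteq> y" "x \<noteq> z" "y \<noteq> z" "x^4 - x^3 - x^2 - x - 1 = 0"
      "y^4 - y^3 - y^2 - y - 1 = 0" "z^4 - z^3 - z^2 - z - 1 = 0" for x y z :: complex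
  proof -
    have "(y-z) * (x^2 + y^2 + z^2 + x*y + x*z + y*z - (x+y+z) - 1) = 0"
      using d1[of x y] d1[of x z] that by algebra
    then show ?thesis using that(3) by simp
  qed
  have "(c-d) * (a+b+c+d-1) = 0" using d2[of a b c] d2[of a b d] d r by algebra
  then show 1: "a + b + c + d = 1" using d by simp
  show 2: "a*b + c*d + (a+b)*(c+d) = -1" using 1 d2[of a b c] d r by algebra
  show 3: "a*b*(c+d) + c*d*(a+b) = 1" using 1 2 d1[of a b] d r by algebra
  show "a*b*(c*d) = -1" using 1 2 3 r(1) by algebra
qed

text \<open>The left-hand side is the resultant of the Tetranacci polynomial with the cubic in the
  denominator of the coefficients.  Pairing the factors halves the number of variables: the
  product over two roots depends only on their sum and their product, and the sums \<open>s, t\<close> and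
  products \<open>p, q\<close> of the two pairs satisfy a system small enough for ideal membership.\<close>

lemma prod_coef_denominators:
  fixes a b c d :: complex
  assumes "a + b + c + d = 1" "a*b + c*d + (a+b)*(c+d) = -1"
    "a*b*(c+d) + c*d*(a+b) = 1" "a*b*(c*d) = -1"
  shows "(-(a^3) + 6*a - 1) * (-(b^3) + 6*b - 1) * (-(c^3) + 6*c - 1) * (-(d^3) + 6*d - 1) = -563"
proof -
  have pair: "(-(x^3) + 6*x - 1) * (-(y^3) + 6*y - 1) =
      p^3 - 6*p*(s^2 - 2*p) + (s^3 - 3*p*s) + 36*p - 6*s + 1"
    if "s = x + y" "p = x * y" for x y s p :: complex
    unfolding that by algebra
  have "(p^3 - 6*p*(s^2 - 2*p) + (s^3 - 3*p*s) + 36*p - 6*s + 1)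
      * (q^3 - 6*q*(t^2 - 2*q) + (t^3 - 3*q*t) + 36*q - 6*t + 1) = -563"
    if "s + t = 1" "p + q + s*t = -1" "p*t + q*s = 1" "p*q = -1" for s p t q :: complex
    using that by algebra
  from this[of "a + b" "c + d" "a * b" "c * d"] show ?thesis
    using assms pair[of "a + b" a b "a * b"] pair[of "c + d" c d "c * d"]
    by (simp add: add.assoc mult.assoc)
qed

lemma tetranacci_roots_symmetric_functions:
  assumes "tetranacci_roots lam"
  shows "lam 1 + lam 2 + lam 3 + lam 4 = 1"
    and "coef lam 1 * coef lam 2 * coef lam 3 * coef lam 4 = -1 / 563"
proof -
  have inj: "inj_on lam {1..4}"
    and img: "lam ` {1..4} = {z. z^4 - z^3 - z^2 - z - 1 = 0}"
    using assms by (auto simp: tetranacci_roots_def bij_betw_def)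
  have d: "lam i \<noteq> lam j" if "i \<in> {1..4}" "j \<in> {1..4}" "i \<noteq> j" for i j
    using inj that by (auto dest: inj_onD)
  have r: "lam i ^ 4 - lam i ^ 3 - lam i ^ 2 - lam i - 1 = 0" if "i \<in> {1..4}" for i
    using img that by blast
  have distinct: "lam 1 \<noteq> lam 2" "lam 1 \<noteq> lam 3" "lam 1 \<noteq> lam 4" "lam 2 \<noteq> lam 3"
    "lam 2 \<noteq> lam 4" "lam 3 \<noteq> lam 4"
    by (simp_all add: d)
  note v = vieta[OF distinct r r r r, simplified]
  show "lam 1 + lam 2 + lam 3 + lam 4 = 1" using v(1) by simp
  have "coef lam 1 * coef lam 2 * coef lam 3 * coef lam 4 =
      1 / ((-(lam 1^3) + 6*lam 1 - 1) * (-(lam 2^3) + 6*lam 2 - 1)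
        * (-(lam 3^3) + 6*lam 3 - 1) * (-(lam 4^3) + 6*lam 4 - 1))"
    unfolding coef_def by (simp only: times_divide_times_eq mult_1)
  also have "\<dots> = 1 / (-563)"
    by (subst prod_coef_denominators) (use v in \<open>simp_all add: mult.assoc\<close>)
  finally show "coef lam 1 * coef lam 2 * coef lam 3 * coef lam 4 = -1 / 563" by simp
qed


section \<open>Multinomial convolutions\<close>

text \<open>A coefficient of a product of several series is a sum over tuples of indices with given
  total.  Such a tuple is split into its first index \<open>k\<close> and the rest \<open>r\<close>, whose total is \<open>w r\<close>; the
  type of \<open>r\<close> is left open, so that one lemma serves tuples of every length.\<close>

lemma compositions_Cons:
  fixes w :: "'b \<Rightarrow> nat"
  shows "{(k, r). k + w r = m} = (SIGMA k:{0..m}. {r. w r = m - k})"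
  by auto

lemma sum_compositions_Cons:
  fixes w :: "'b \<Rightarrow> nat" and F :: "'a::comm_ring_1 fps"
  assumes "\<And>j. finite {r. w r = j}"
  shows "(\<Sum>(k, r)\<in>{(k, r). k + w r = m}. F $ k * g r) =
    (F * Abs_fps (\<lambda>j. \<Sum>r\<in>{r. w r = j}. g r)) $ m"
  unfolding compositions_Cons fps_mult_nth
  by (subst sum.Sigma[symmetric]) (auto simp: assms sum_distrib_left)

lemma finite_compositions_Cons:
  fixes w :: "'b \<Rightarrow> nat"
  assumes "\<And>j. finite {r. w r = j}"
  shows "finite {(k, r). k + w r = m}"
  unfolding compositions_Cons using assms by auto

lemma finite_compositions:
  "finite {(k1, k2). k1 + k2 = (m::nat)}"
  "finite {(k1, k2, k3). k1 + (k2 + k3) = (m::nat)}"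
  "finite {(k1, k2, k3, k4). k1 + (k2 + (k3 + k4)) = (m::nat)}"
proof -
  have 2: "finite {(k1, k2). k1 + k2 = (m::nat)}" for m
    using finite_compositions_Cons[of "\<lambda>k. k" m] by simp
  have 3: "finite {(k1, k2, k3). k1 + (k2 + k3) = (m::nat)}" for m
    using finite_compositions_Cons[of "\<lambda>(k, l). k + l" m] 2 by (simp add: case_prod_unfold)
  show "finite {(k1, k2). k1 + k2 = (m::nat)}" "finite {(k1, k2, k3). k1 + (k2 + k3) = (m::nat)}"
    by (fact 2 3)+
  show "finite {(k1, k2, k3, k4). k1 + (k2 + (k3 + k4)) = (m::nat)}"
    using finite_compositions_Cons[of "\<lambda>(k, l, j). k + (l + j)" m] 3
    by (simp add: case_prod_unfold)
qed

lemma fps_mult2_nth: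
  fixes F1 F2 :: "'a::comm_ring_1 fps"
  shows "(F1 * F2) $ m = (\<Sum>(k1, k2)\<in>{(k1, k2). k1 + k2 = m}. F1 $ k1 * F2 $ k2)"
  using sum_compositions_Cons[of "\<lambda>k. k" F1 "\<lambda>k. F2 $ k" m] by (simp add: fps_nth_inverse)

lemma fps_mult3_nth:
  fixes F1 F2 F3 :: "'a::comm_ring_1 fps"
  shows "(F1 * F2 * F3) $ m =
    (\<Sum>(k1, k2, k3)\<in>{(k1, k2, k3). k1 + k2 + k3 = m}. F1 $ k1 * F2 $ k2 * F3 $ k3)"
proof -
  have "F2 * F3 = Abs_fps (\<lambda>j. \<Sum>(k2, k3)\<in>{(k2, k3). k2 + k3 = j}. F2 $ k2 * F3 $ k3)"
    by (simp add: fps_eq_iff fps_mult2_nth)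
  then show ?thesis
    using sum_compositions_Cons[of "\<lambda>(k, l). k + l" F1 "\<lambda>(k, l). F2 $ k * F3 $ l" m]
    finite_compositions(1)
    by (simp add: case_prod_unfold mult.assoc add.assoc)
qed

lemma fps_mult4_nth:
  fixes F1 F2 F3 F4 :: "'a::comm_ring_1 fps"
  shows "(F1 * F2 * F3 * F4) $ m =
    (\<Sum>(k1, k2, k3, k4)\<in>{(k1, k2, k3, k4). k1 + k2 + k3 + k4 = m}.
      F1 $ k1 * F2 $ k2 * F3 $ k3 * F4 $ k4)"
proof -
  have "F2 * F3 * F4 = Abs_fps (\<lambda>j. \<Sum>(k2, k3, k4)\<in>{(k2, k3, k4). k2 + (k3 + k4) = j}.
      F2 $ k2 * F3 $ k3 * F4 $ k4)"
    by (simp add: fps_eq_iff fps_mult3_nth add.assoc)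
  then show ?thesis
    using sum_compositions_Cons[of "\<lambda>(k, l, j). k + (l + j)" F1
        "\<lambda>(k, l, j). F2 $ k * F3 $ l * F4 $ j" m] finite_compositions(2)
    by (simp add: case_prod_unfold mult.assoc add.assoc)
qed

lemma fps_mult5_nth:
  fixes F1 F2 F3 F4 F5 :: "'a::comm_ring_1 fps"
  shows "(F1 * F2 * F3 * F4 * F5) $ m =
    (\<Sum>(k1, k2, k3, k4, k5)\<in>{(k1, k2, k3, k4, k5). k1 + k2 + k3 + k4 + k5 = m}.
      F1 $ k1 * F2 $ k2 * F3 $ k3 * F4 $ k4 * F5 $ k5)"
proof -
  have "F2 * F3 * F4 * F5 = Abs_fps (\<lambda>j. \<Sum>(k2, k3, k4, k5)\<in>{(k2, k3, k4, k5). k2 + (k3 + (k4 + k5)) = j}.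
      F2 $ k2 * F3 $ k3 * F4 $ k4 * F5 $ k5)"
    by (simp add: fps_eq_iff fps_mult4_nth add.assoc)
  then show ?thesis
    using sum_compositions_Cons[of "\<lambda>(k, l, j, i). k + (l + (j + i))" F1
        "\<lambda>(k, l, j, i). F2 $ k * F3 $ l * F4 $ j * F5 $ i" m] finite_compositions(3)
    by (simp add: case_prod_unfold mult.assoc add.assoc)
qed

text \<open>For exponential generating functions the factorials combine to multinomial coefficients.\<close>

lemma egf_mult2:
  "fact m * (egf f * egf g) $ m = (\<Sum>k=0..m. of_nat (m choose k) * f k * g (m - k))"
  unfolding fps_mult_nth sum_distrib_left
  by (intro sum.cong) (simp_all add: egf_def binomial_fact)

lemma egf_mult3:
  "fact m * (egf f * egf g * egf h) $ m =
    (\<Sum>(k1, k2, k3)\<in>{(k1, k2, k3). k1 + k2 + k3 = m}.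
      multinomial m [k1, k2, k3] * f k1 * g k2 * h k3)"
  unfolding fps_mult3_nth sum_distrib_left
  by (intro sum.cong) (auto simp: egf_def multinomial_def mult.assoc)

lemma egf_mult4:
  "fact m * (egf f1 * egf f2 * egf f3 * egf f4) $ m =
    (\<Sum>(k1, k2, k3, k4)\<in>{(k1, k2, k3, k4). k1 + k2 + k3 + k4 = m}.
      multinomial m [k1, k2, k3, k4] * f1 k1 * f2 k2 * f3 k3 * f4 k4)"
  unfolding fps_mult4_nth sum_distrib_left
  by (intro sum.cong) (auto simp: egf_def multinomial_def mult.assoc)

lemma egf_mult5:
  "fact m * (egf f1 * egf f2 * egf f3 * egf f4 * egf f5) $ m =
    (\<Sum>(k1, k2, k3, k4, k5)\<in>{(k1, k2, k3, k4, k5). k1 + k2 + k3 + k4 + k5 = m}.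
      multinomial m [k1, k2, k3, k4, k5] * f1 k1 * f2 k2 * f3 k3 * f4 k4 * f5 k5)"
  unfolding fps_mult5_nth sum_distrib_left
  by (intro sum.cong) (auto simp: egf_def multinomial_def mult.assoc)

section \<open>Symmetric quintic forms in four variables\<close>

text \<open>The last two identities reflect that in four variables \<open>q2\<close> and \<open>q3\<close> are the monomial
  symmetric functions \<open>m\<^sub>2\<^sub>1\<^sub>1\<close> and \<open>m\<^sub>2\<^sub>2\<^sub>1\<close>.  In \<open>p 1 * e3\<close> the product of all variables arises once
  for each variable, hence 4 times; in \<open>e2 * e3\<close> the monomial \<open>y1^2 * y2 * y3 * y4\<close> arises once for
  each partner of \<open>y1\<close> in \<open>e2\<close>, hence 3 times.\<close>

lemma newton_identities_four:
  fixes y1 y2 y3 y4 :: "'a::comm_ring_1"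
  defines "p \<equiv> \<lambda>r::nat. y1^r + y2^r + y3^r + y4^r"
    and "e2 \<equiv> y1*y2 + y1*y3 + y1*y4 + y2*y3 + y2*y4 + y3*y4"
    and "e3 \<equiv> y1*y2*y3 + y1*y2*y4 + y1*y3*y4 + y2*y3*y4"
    and "e4 \<equiv> y1*y2*y3*y4"
    and "q2 \<equiv> y1*y2*y3*(y1+y2+y3) + y1*y2*y4*(y1+y2+y4) + y1*y3*y4*(y1+y3+y4) + y2*y3*y4*(y2+y3+y4)"
    and "q3 \<equiv> y1*y2*y3*(y1*y2+y2*y3+y3*y1) + y1*y2*y4*(y1*y2+y2*y4+y4*y1)
            + y1*y3*y4*(y1*y3+y3*y4+y4*y1) + y2*y3*y4*(y2*y3+y3*y4+y4*y2)"
  shows "p 2 = p 1^2 - 2*e2"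
    and "p 3 = p 1^3 - 3*p 1*e2 + 3*e3"
    and "p 4 = p 1 * p 3 - e2 * p 2 + e3 * p 1 - 4 * e4"
    and "p 5 = p 1 * p 4 - e2 * p 3 + e3 * p 2 - e4 * p 1"
    and "q2 = p 1 * e3 - 4 * e4"
    and "q3 = e2 * e3 - 3 * p 1 * e4"
  unfolding assms by (simp_all add: algebra_simps eval_nat_numeral)

text \<open>Here \<open>p1\<close>, \<open>e2\<close>, \<open>e3\<close>, \<open>e4\<close> are treated as independent, which is possible since the elementary
  symmetric polynomials are algebraically independent.  The identity is then one between
  polynomials with only six monomials of weight 5.\<close>

lemma quintic_expansion:
  fixes p1 p2 p3 p4 p5 e2 e3 e4 q2 q3 :: "'a::comm_ring_1"
  assumes "p2 = p1^2 - 2*e2" "p3 = p1^3 - 3*p1*e2 + 3*e3" "p4 = p1 * p3 - e2 * p2 + e3 * p1 - 4 * e4"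
   "p5 = p1 * p4 - e2 * p3 + e3 * p2 - e4 * p1" "q2 = p1 * e3 - 4 * e4" "q3 = e2 * e3 - 3 * p1 * e4"
    and "A = - G - J - M + 2*N - P - Q - 3*S + 6"
    and "B = - 2*G - K - 2*M - 2*N - 5*P - 2*Q - 6*R - 12*S + 30"
    and "E = G + J + M - N + 2*P + 2*Q + 3*R + 6*S - 15"
    and "F = - 3*G - J - 3*K - 7*M - 12*P - 3*Q - 6*R - 27*S + 60"
    and "H = - L - 2*N - P - Q - 4*R - 3*S + 10"
    and "I = - G - J - 2*L - M - 2*P - 3*Q - 6*R - 7*S + 20"
  shows "B * q3 = p1^5 - A * p5 - E * (p4*p1) - F * (e4 * p1) - G * (q2 * p1) - H * (p3 * p2)
   - I * (p3 * e2)
   - J * (e3 * p2) - K * (e3 * e2) - L * (p3 * p1^2) - M * (e3 * p1^2) - N * (p2^2*p1) - P * (e2^2*p1)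
   - Q * (p2 * e2 * p1) - R * (p2 * p1^3) - S * (e2 * p1^3)"
  unfolding assms by (simp add: algebra_simps eval_nat_numeral)

section \<open>Symmetric functions of the four exponential terms\<close>

definition exp_term :: "(nat \<Rightarrow> complex) \<Rightarrow> nat \<Rightarrow> nat \<Rightarrow> complex fps" where
  "exp_term lam n i = fps_const (coef lam i ^ n) * fps_exp (lam i)"

definition power_sum :: "(nat \<Rightarrow> complex) \<Rightarrow> nat \<Rightarrow> nat \<Rightarrow> complex fps" where
  "power_sum lam n r = exp_term lam n 1 ^ r + exp_term lam n 2 ^ r + exp_term lam n 3 ^ r + exp_term lam n 4 ^ r"

lemma sum_1_to_4: "(\<Sum>i\<in>{1..4::nat}. f i) = f 1 + f 2 + f 3 + (f 4 :: 'a::comm_monoid_add)"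
  by (simp add: eval_nat_numeral ac_simps)

lemma sum_triples_below_4:
  fixes f :: "nat \<times> nat \<times> nat \<Rightarrow> 'a::comm_monoid_add"
  shows "sum f {(i, j, l). 1 \<le> i \<and> i < j \<and> j < l \<and> l \<le> 4} =
    f (1, 2, 3) + f (1, 2, 4) + f (1, 3, 4) + f (2, 3, 4)"
proof -
  have "{(i, j, l). 1 \<le> i \<and> i < j \<and> j < l \<and> l \<le> (4::nat)} =
      {(1, 2, 3), (1, 2, 4), (1, 3, 4), (2, 3, 4)}"
    by auto
  then show ?thesis by (simp add: ac_simps)
qed

lemma exp_term_power:
  "exp_term lam n i ^ r = fps_const (coef lam i ^ (r * n)) * fps_exp (of_nat r * lam i)"
  by (simp add: exp_term_def power_mult_distrib fps_exp_power_mult fps_const_power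
      power_mult[symmetric] mult.commute)

text \<open>Passing from \<open>n\<close> to \<open>r * n\<close> raises the coefficients to the power \<open>r\<close>, and the factor
  \<open>of_nat r ^ k\<close>, which substitutes \<open>r x\<close> for \<open>x\<close>, does the same to the exponentials.\<close>

lemma power_sum_eq_gf1:
  "power_sum lam n r = Abs_fps (\<lambda>k. of_nat r ^ k * gf1 lam (r * n) $ k)"
  unfolding power_sum_def exp_term_power gf1_def sum_1_to_4
  by (simp add: fps_eq_iff power_mult_distrib algebra_simps)

lemma t2_gf_eq:
  "t2_gf lam n = (let y1 = exp_term lam n 1; y2 = exp_term lam n 2;
       y3 = exp_term lam n 3; y4 = exp_term lam n 4 in
     y1*y2*y3*(y1+y2+y3) + y1*y2*y4*(y1+y2+y4) + y1*y3*y4*(y1+y3+y4) + y2*y3*y4*(y2+y3+y4))"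
  unfolding t2_gf_def sum_triples_below_4 Let_def prod.case exp_term_def fps_exp_add_mult
    fps_const_mult[symmetric]
  by (simp only: ac_simps)

lemma t3_gf_eq:
  "t3_gf lam n = (let y1 = exp_term lam n 1; y2 = exp_term lam n 2;
       y3 = exp_term lam n 3; y4 = exp_term lam n 4 in
     y1*y2*y3*(y1*y2+y2*y3+y3*y1) + y1*y2*y4*(y1*y2+y2*y4+y4*y1)
     + y1*y3*y4*(y1*y3+y3*y4+y4*y1) + y2*y3*y4*(y2*y3+y3*y4+y4*y2))"
  unfolding t3_gf_def sum_triples_below_4 Let_def prod.case exp_term_def fps_exp_add_mult
    fps_const_mult[symmetric]
  by (simp only: ac_simps)

lemma elementary_4_exp_terms:
  assumes "tetranacci_roots lam"
  shows "exp_term lam n 1 * exp_term lam n 2 * exp_term lam n 3 * exp_term lam n 4 =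
    fps_const ((- 1 / 563) ^ n) * fps_exp 1"
proof -
  have "exp_term lam n 1 * exp_term lam n 2 * exp_term lam n 3 * exp_term lam n 4 =
      fps_const ((coef lam 1 * coef lam 2 * coef lam 3 * coef lam 4) ^ n)
      * fps_exp (lam 1 + lam 2 + lam 3 + lam 4)"
    unfolding exp_term_def power_mult_distrib fps_exp_add_mult fps_const_mult[symmetric]
    by (simp only: ac_simps)
  then show ?thesis using tetranacci_roots_symmetric_functions[OF assms] by simp
qed

text \<open>The factor \<open>(-1) ^ k\<close> substitutes \<open>- x\<close> for \<open>x\<close>.  As the roots add up to 1, the product of
  \<open>exp (- \<lambda>\<^sub>i x)\<close> and \<open>exp x\<close> is the exponential of the sum of the three roots other than \<open>\<lambda>\<^sub>i\<close>.\<close>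

lemma elementary_3_exp_terms:
  assumes "tetranacci_roots lam"
  shows "(let y1 = exp_term lam n 1; y2 = exp_term lam n 2;
       y3 = exp_term lam n 3; y4 = exp_term lam n 4 in
     y1*y2*y3 + y1*y2*y4 + y1*y3*y4 + y2*y3*y4) =
    Abs_fps (\<lambda>k. (-1) ^ k * gf2 lam n $ k) * fps_exp 1"
proof -
  have s: "lam 1 + lam 2 + lam 3 + lam 4 = 1"
    by (rule tetranacci_roots_symmetric_functions[OF assms])
  have compl: "{1..4} - {1} = {2,3,4::nat}" "{1..4} - {2} = {1,3,4::nat}"
    "{1..4} - {3} = {1,2,4::nat}" "{1..4} - {4} = {1,2,3::nat}"
    by auto
  have "Abs_fps (\<lambda>k. (-1) ^ k * gf2 lam n $ k) =
      (\<Sum>i\<in>{1..4}. fps_const (\<Prod>j\<in>{1..4} - {i}. coef lam j ^ n) * fps_exp (- lam i))"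
    unfolding gf2_def sum_1_to_4
    by (simp add: fps_eq_iff power_minus[of "lam _"] algebra_simps)
  also have "\<dots> * fps_exp 1 =
      (\<Sum>i\<in>{1..4}. fps_const (\<Prod>j\<in>{1..4} - {i}. coef lam j ^ n)
         * fps_exp (- lam i + (lam 1 + lam 2 + lam 3 + lam 4)))"
    unfolding fps_exp_add_mult[of "- lam _"] s by (simp add: sum_distrib_right mult.assoc)
  also have "\<dots> = (let y1 = exp_term lam n 1; y2 = exp_term lam n 2;
       y3 = exp_term lam n 3; y4 = exp_term lam n 4 in
     y1*y2*y3 + y1*y2*y4 + y1*y3*y4 + y2*y3*y4)"
    unfolding sum_1_to_4 compl
    by (simp add: Let_def exp_term_def fps_exp_add_mult fps_const_mult[symmetric] ac_simps
        del: fps_const_mult)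
  finally show ?thesis by simp
qed

lemma normalized_egf_scale:
  assumes "normalized_egf f a u"
  shows "egf (\<lambda>k. c ^ k * of_int (u k)) = fps_const (of_rat a) * Abs_fps (\<lambda>k. c ^ k * f $ k)"
proof -
  have "f = fps_const (1 / of_rat a) * egf (\<lambda>k. of_int (u k))" "a \<noteq> 0"
    using assms by (auto simp: normalized_egf_def)
  then show ?thesis by (simp add: fps_eq_iff egf_def)
qed

text \<open>The shape in which each term of the formula arises: \<open>s\<close> is a convolution sum of the integer
  sequences, \<open>W\<close> the product of their generating functions, \<open>X\<close> the corresponding product of
  symmetric functions, and \<open>d\<close> collects the normalizing constants.\<close>

lemma coefficient_of_scaled:
  fixes X W :: "complex fps"
  assumes "d \<noteq> 0" "W = fps_const d * X" "fact m * W $ m = s"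
  shows "x / d * s = x * (fact m * X $ m)"
  using assms by auto

section \<open>The formula\<close>

theorem theorem17:
  fixes lam :: "nat \<Rightarrow> complex"
    and A1 A2 :: "nat \<Rightarrow> rat"
    and U V :: "nat \<Rightarrow> nat \<Rightarrow> int"
    and A B E F G H I J K L M N P Q R S :: complex
    and m n :: nat
  assumes roots: "tetranacci_roots lam"
    and U: "\<And>r. r \<ge> 1 \<Longrightarrow> normalized_egf (gf1 lam r) (A1 r) (U r)"
    and V: "\<And>r. r \<ge> 1 \<Longrightarrow> normalized_egf (gf2 lam r) (A2 r) (V r)"
    and A: "A = - G - J - M + 2*N - P - Q - 3*S + 6"
    and B: "B = - 2*G - K - 2*M - 2*N - 5*P - 2*Q - 6*R - 12*S + 30"
    and E: "E = G + J + M - N + 2*P + 2*Q + 3*R + 6*S - 15"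
    and F: "F = - 3*G - J - 3*K - 7*M - 12*P - 3*Q - 6*R - 27*S + 60"
    and H: "H = - L - 2*N - P - Q - 4*R - 3*S + 10"
    and I: "I = - G - J - 2*L - M - 2*P - 3*Q - 6*R - 7*S + 20"
    and B_nz: "B \<noteq> 0"
    and n: "n \<ge> 1"
  shows "B * t3 lam n m =
          1 / (of_rat (A1 n)) ^ 5
          * (\<Sum>(k1, k2, k3, k4, k5)\<in>{(k1, k2, k3, k4, k5). k1 + k2 + k3 + k4 + k5 = m}.
              multinomial m [k1, k2, k3, k4, k5] * of_int (U n k1) * of_int (U n k2) * of_int (U n k3) * of_int (U n k4) * of_int (U n k5))
        - A / of_rat (A1 (5 * n)) * 5 ^ m * of_int (U (5 * n) m)
        - E / (of_rat (A1 (4 * n)) * of_rat (A1 n))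
          * (\<Sum>k=0..m. of_nat (m choose k) * 4 ^ (m - k) * of_int (U (4 * n) (m - k)) * of_int (U n k))
        - F / of_rat (A1 n) * (- 1 / 563) ^ n * (\<Sum>k=0..m. of_nat (m choose k) * of_int (U n k))
        - G / of_rat (A1 n) * (\<Sum>k=0..m. of_nat (m choose k) * t2 lam n k * of_int (U n (m - k)))
        - H / (of_rat (A1 (3 * n)) * of_rat (A1 (2 * n)))
          * (\<Sum>k=0..m. of_nat (m choose k) * 3 ^ (m - k) * 2 ^ k * of_int (U (3 * n) (m - k)) * of_int (U (2 * n) k))
        - I / of_rat (A1 (3 * n)) * (\<Sum>k=0..m. of_nat (m choose k) * 3 ^ k * of_int (U (3 * n) k) * t1 A1 U n (m - k))
        - J / (of_rat (A2 n) * of_rat (A1 (2 * n)))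
          * (\<Sum>(k1, k2, k3)\<in>{(k1, k2, k3). k1 + k2 + k3 = m}.
              multinomial m [k1, k2, k3] * (-1) ^ k1 * of_int (V n k1) * 2 ^ k2 * of_int (U (2 * n) k2))
        - K / of_rat (A2 n)
          * (\<Sum>(k1, k2, k3)\<in>{(k1, k2, k3). k1 + k2 + k3 = m}.
              multinomial m [k1, k2, k3] * (-1) ^ k1 * of_int (V n k1) * t1 A1 U n k2)
        - L / (of_rat (A1 (3 * n)) * (of_rat (A1 n)) ^ 2)
          * (\<Sum>(k1, k2, k3)\<in>{(k1, k2, k3). k1 + k2 + k3 = m}.
              multinomial m [k1, k2, k3] * 3 ^ k1 * of_int (U (3 * n) k1) * of_int (U n k2) * of_int (U n k3))
        - M / (of_rat (A2 n) * (of_rat (A1 n)) ^ 2)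
          * (\<Sum>(k1, k2, k3, k4)\<in>{(k1, k2, k3, k4). k1 + k2 + k3 + k4 = m}.
              multinomial m [k1, k2, k3, k4] * (-1) ^ k1 * of_int (V n k1) * of_int (U n k2) * of_int (U n k3))
        - N / ((of_rat (A1 (2 * n))) ^ 2 * of_rat (A1 n))
          * (\<Sum>(k1, k2, k3)\<in>{(k1, k2, k3). k1 + k2 + k3 = m}.
              multinomial m [k1, k2, k3] * 2 ^ k1 * of_int (U (2 * n) k1) * 2 ^ k2 * of_int (U (2 * n) k2) * of_int (U n k3))
        - P / of_rat (A1 n)
          * (\<Sum>(k1, k2, k3)\<in>{(k1, k2, k3). k1 + k2 + k3 = m}.
              multinomial m [k1, k2, k3] * t1 A1 U n k1 * t1 A1 U n k2 * of_int (U n k3))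
        - Q / (of_rat (A1 (2 * n)) * of_rat (A1 n))
          * (\<Sum>(k1, k2, k3)\<in>{(k1, k2, k3). k1 + k2 + k3 = m}.
              multinomial m [k1, k2, k3] * 2 ^ k1 * of_int (U (2 * n) k1) * t1 A1 U n k2 * of_int (U n k3))
        - R / (of_rat (A1 (2 * n)) * (of_rat (A1 n)) ^ 3)
          * (\<Sum>(k1, k2, k3, k4)\<in>{(k1, k2, k3, k4). k1 + k2 + k3 + k4 = m}.
              multinomial m [k1, k2, k3, k4] * 2 ^ k1 * of_int (U (2 * n) k1) * of_int (U n k2) * of_int (U n k3) * of_int (U n k4))
        - S / (of_rat (A1 n)) ^ 3
          * (\<Sum>(k1, k2, k3, k4)\<in>{(k1, k2, k3, k4). k1 + k2 + k3 + k4 = m}.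
              multinomial m [k1, k2, k3, k4] * t1 A1 U n k1 * of_int (U n k2) * of_int (U n k3) * of_int (U n k4))"
proof -
  define y where "y = exp_term lam n"
  define p where "p = power_sum lam n"
  define e2 where "e2 = y 1*y 2 + y 1*y 3 + y 1*y 4 + y 2*y 3 + y 2*y 4 + y 3*y 4"
  define e3 where "e3 = y 1*y 2*y 3 + y 1*y 2*y 4 + y 1*y 3*y 4 + y 2*y 3*y 4"
  define e4 where "e4 = y 1*y 2*y 3*y 4"
  define a :: "nat \<Rightarrow> complex" where "a r = of_rat (A1 (r * n))" for r
  define b :: complex where "b = of_rat (A2 n)"
  define u :: "nat \<Rightarrow> nat \<Rightarrow> complex" where "u r = (\<lambda>k. of_nat r ^ k * of_int (U (r * n) k))" for r
  define v :: "nat \<Rightarrow> complex" where "v = (\<lambda>k. (-1) ^ k * of_int (V n k))"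
  define t where "t = t1 A1 U n"

  have a_nz: "a r \<noteq> 0" if "r \<ge> 1" for r
    using U[of "r * n"] n that by (simp add: a_def normalized_egf_def)
  have b_nz: "b \<noteq> 0"
    using V[OF n] by (simp add: b_def normalized_egf_def)
  have egf_u: "egf (u r) = fps_const (a r) * p r" if "r \<ge> 1" for r
    using normalized_egf_scale[OF U[of "r * n"], of "of_nat r"] n that
    by (simp add: u_def a_def p_def power_sum_eq_gf1)
  have egf_one: "egf (\<lambda>_. 1) = fps_exp 1"
    by (simp add: fps_eq_iff egf_def)
  have e3: "egf v * egf (\<lambda>_. 1) = fps_const b * e3"
    using normalized_egf_scale[OF V[OF n], of "-1"] elementary_3_exp_terms[OF roots, of n]
    by (simp add: egf_one v_def b_def e3_def y_def Let_def mult.assoc)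
  have e4: "e4 = fps_const ((- 1 / 563) ^ n) * fps_exp 1"
    unfolding e4_def y_def by (rule elementary_4_exp_terms[OF roots])

  have p: "p r = y 1 ^ r + y 2 ^ r + y 3 ^ r + y 4 ^ r" for r
    by (simp add: p_def y_def power_sum_def)
  note newton = newton_identities_four[of "y 1" "y 2" "y 3" "y 4", folded p e2_def e3_def e4_def]
  have t2: "t2_gf lam n = p 1 * e3 - 4 * e4"
    using newton(5) by (simp add: t2_gf_eq y_def Let_def)
  have t3: "t3_gf lam n = e2 * e3 - 3 * p 1 * e4"
    using newton(6) by (simp add: t3_gf_eq y_def Let_def)

  have egf_t: "egf t = e2"
  proof (rule fps_ext)
    fix k
    have "1 / (a 1)^2 * (\<Sum>i=0..k. of_nat (k choose i) * of_int (U n i) * of_int (U n (k - i))) =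
        1 * (fact k * (p 1 * p 1) $ k)"
    proof (rule coefficient_of_scaled)
      show "egf (u 1) * egf (u 1) = fps_const (a 1 ^ 2) * (p 1 * p 1)"
        by (simp add: egf_u power2_eq_square mult_ac flip: fps_const_mult)
    qed (unfold egf_mult2, simp_all add: a_nz u_def mult_ac)
    moreover have "fact k * p 2 $ k = 2 ^ k / a 2 * of_int (U (2 * n) k)"
      using arg_cong[OF egf_u[of 2], of "\<lambda>f. f $ k"] a_nz[of 2]
      by (simp add: egf_def u_def field_simps)
    moreover have "2 * e2 $ k = (p 1 * p 1) $ k - p 2 $ k"
      using arg_cong[OF newton(1), of "\<lambda>f. f $ k"]
      by (simp add: power2_eq_square numeral_fps_const)
    then have "fact k * (2 * e2 $ k) = fact k * (p 1 * p 1) $ k - fact k * p 2 $ k"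
      by (simp only: right_diff_distrib)
    ultimately have "fact k * (2 * e2 $ k) = 2 * t k"
      by (simp add: t_def t1_def a_def)
    then show "egf t $ k = e2 $ k"
      by (simp add: egf_def field_simps)
  qed

  have T0: "1 / (a 1) ^ 5
          * (\<Sum>(k1, k2, k3, k4, k5)\<in>{(k1, k2, k3, k4, k5). k1 + k2 + k3 + k4 + k5 = m}.
              multinomial m [k1, k2, k3, k4, k5] * of_int (U n k1) * of_int (U n k2) * of_int (U n k3) * of_int (U n k4) * of_int (U n k5))
      = 1 * (fact m * (p 1 ^ 5) $ m)"
  proof (rule coefficient_of_scaled)
    show "egf (u 1) * egf (u 1) * egf (u 1) * egf (u 1) * egf (u 1) = fps_const (a 1 ^ 5) * p 1 ^ 5"
      unfolding egf_u[OF order_refl] fps_const_power[symmetric] by algebra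
  qed (unfold egf_mult5, simp_all add: a_nz u_def mult_ac)
  have TA: "A / a 5 * 5 ^ m * of_int (U (5 * n) m) = A * (fact m * p 5 $ m)"
    using arg_cong[OF egf_u[of 5], of "\<lambda>f. f $ m"] a_nz[of 5]
    by (simp add: egf_def u_def field_simps)
  have TE: "E / (a 4 * a 1)
          * (\<Sum>k=0..m. of_nat (m choose k) * 4 ^ (m - k) * of_int (U (4 * n) (m - k)) * of_int (U n k))
      = E * (fact m * (p 4 * p 1) $ m)"
  proof (rule coefficient_of_scaled)
    show "egf (u 1) * egf (u 4) = fps_const (a 4 * a 1) * (p 4 * p 1)"
      by (simp add: egf_u mult_ac flip: fps_const_mult)
  qed (unfold egf_mult2, simp_all add: a_nz u_def mult_ac)
  have TF: "F / a 1 * (- 1 / 563) ^ n * (\<Sum>k=0..m. of_nat (m choose k) * of_int (U n k))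
      = F * (fact m * (e4 * p 1) $ m)"
  proof -
    have *: "F / a 1 * (\<Sum>k=0..m. of_nat (m choose k) * of_int (U n k))
        = F * (fact m * (fps_exp 1 * p 1) $ m)"
    proof (rule coefficient_of_scaled)
      show "egf (u 1) * egf (\<lambda>_. 1) = fps_const (a 1) * (fps_exp 1 * p 1)"
        by (simp add: egf_u egf_one mult_ac)
    qed (unfold egf_mult2, simp_all add: a_nz u_def mult_ac)
    have "F / a 1 * (- 1 / 563) ^ n * (\<Sum>k=0..m. of_nat (m choose k) * of_int (U n k))
        = (- 1 / 563) ^ n * (F / a 1 * (\<Sum>k=0..m. of_nat (m choose k) * of_int (U n k)))"
      by (simp only: mult_ac)
    also have "\<dots> = F * (fact m * ((- 1 / 563) ^ n * (fps_exp 1 * p 1) $ m))"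
      unfolding * by (simp only: mult_ac)
    finally show ?thesis by (simp add: e4 mult.assoc)
  qed
  have TG: "G / a 1 * (\<Sum>k=0..m. of_nat (m choose k) * t2 lam n k * of_int (U n (m - k)))
      = G * (fact m * (t2_gf lam n * p 1) $ m)"
  proof (rule coefficient_of_scaled)
    show "egf (t2 lam n) * egf (u 1) = fps_const (a 1) * (t2_gf lam n * p 1)"
      by (simp add: egf_u egf_t2 mult_ac)
  qed (unfold egf_mult2, simp_all add: a_nz u_def mult_ac)
  have TH: "H / (a 3 * a 2)
          * (\<Sum>k=0..m. of_nat (m choose k) * 3 ^ (m - k) * 2 ^ k * of_int (U (3 * n) (m - k)) * of_int (U (2 * n) k))
      = H * (fact m * (p 3 * p 2) $ m)"
  proof (rule coefficient_of_scaled)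
    show "egf (u 2) * egf (u 3) = fps_const (a 3 * a 2) * (p 3 * p 2)"
      by (simp add: egf_u mult_ac flip: fps_const_mult)
  qed (unfold egf_mult2, simp_all add: a_nz u_def mult_ac)
  have TI: "I / a 3 * (\<Sum>k=0..m. of_nat (m choose k) * 3 ^ k * of_int (U (3 * n) k) * t (m - k))
      = I * (fact m * (p 3 * e2) $ m)"
  proof (rule coefficient_of_scaled)
    show "egf (u 3) * egf t = fps_const (a 3) * (p 3 * e2)"
      by (simp add: egf_u egf_t mult_ac)
  qed (unfold egf_mult2, simp_all add: a_nz u_def mult_ac)
  have TJ: "J / (b * a 2)
          * (\<Sum>(k1, k2, k3)\<in>{(k1, k2, k3). k1 + k2 + k3 = m}.
              multinomial m [k1, k2, k3] * (-1) ^ k1 * of_int (V n k1) * 2 ^ k2 * of_int (U (2 * n) k2))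
      = J * (fact m * (e3 * p 2) $ m)"
  proof (rule coefficient_of_scaled)
    \<comment> \<open>The last index occurs in no factor of the summand: it belongs to \<open>exp x\<close>, the generating
      function of the constant sequence 1, which turns that of \<open>v\<close> into a multiple of \<open>e3\<close>.\<close>
    have "egf v * egf (u 2) * egf (\<lambda>_. 1) = (egf v * egf (\<lambda>_. 1)) * egf (u 2)"
      by (simp only: mult_ac)
    then show "egf v * egf (u 2) * egf (\<lambda>_. 1) = fps_const (b * a 2) * (e3 * p 2)"
      by (simp add: e3 egf_u mult_ac flip: fps_const_mult)
  qed (unfold egf_mult3, simp_all add: a_nz b_nz u_def v_def mult_ac)
  have TK: "K / b
          * (\<Sum>(k1, k2, k3)\<in>{(k1, k2, k3). k1 + k2 + k3 = m}.
              multinomial m [k1, k2, k3] * (-1) ^ k1 * of_int (V n k1) * t k2)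
      = K * (fact m * (e3 * e2) $ m)"
  proof (rule coefficient_of_scaled)
    have "egf v * egf t * egf (\<lambda>_. 1) = (egf v * egf (\<lambda>_. 1)) * egf t"
      by (simp only: mult_ac)
    then show "egf v * egf t * egf (\<lambda>_. 1) = fps_const b * (e3 * e2)"
      by (simp add: e3 egf_t mult_ac)
  qed (unfold egf_mult3, simp_all add: b_nz v_def mult_ac)
  have TL: "L / (a 3 * (a 1) ^ 2)
          * (\<Sum>(k1, k2, k3)\<in>{(k1, k2, k3). k1 + k2 + k3 = m}.
              multinomial m [k1, k2, k3] * 3 ^ k1 * of_int (U (3 * n) k1) * of_int (U n k2) * of_int (U n k3))
      = L * (fact m * (p 3 * p 1 ^ 2) $ m)"
  proof (rule coefficient_of_scaled)
    show "egf (u 3) * egf (u 1) * egf (u 1) = fps_const (a 3 * a 1 ^ 2) * (p 3 * p 1 ^ 2)"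
      by (simp add: egf_u power2_eq_square mult_ac flip: fps_const_mult)
  qed (unfold egf_mult3, simp_all add: a_nz u_def mult_ac)
  have TM: "M / (b * (a 1) ^ 2)
          * (\<Sum>(k1, k2, k3, k4)\<in>{(k1, k2, k3, k4). k1 + k2 + k3 + k4 = m}.
              multinomial m [k1, k2, k3, k4] * (-1) ^ k1 * of_int (V n k1) * of_int (U n k2) * of_int (U n k3))
      = M * (fact m * (e3 * p 1 ^ 2) $ m)"
  proof (rule coefficient_of_scaled)
    have "egf v * egf (u 1) * egf (u 1) * egf (\<lambda>_. 1) = (egf v * egf (\<lambda>_. 1)) * egf (u 1) * egf (u 1)"
      by (simp only: mult_ac)
    then show "egf v * egf (u 1) * egf (u 1) * egf (\<lambda>_. 1) = fps_const (b * a 1 ^ 2) * (e3 * p 1 ^ 2)"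
      by (simp add: e3 egf_u power2_eq_square mult_ac flip: fps_const_mult)
  qed (unfold egf_mult4, simp_all add: a_nz b_nz u_def v_def mult_ac)
  have TN: "N / ((a 2) ^ 2 * a 1)
          * (\<Sum>(k1, k2, k3)\<in>{(k1, k2, k3). k1 + k2 + k3 = m}.
              multinomial m [k1, k2, k3] * 2 ^ k1 * of_int (U (2 * n) k1) * 2 ^ k2 * of_int (U (2 * n) k2) * of_int (U n k3))
      = N * (fact m * (p 2 ^ 2 * p 1) $ m)"
  proof (rule coefficient_of_scaled)
    show "egf (u 2) * egf (u 2) * egf (u 1) = fps_const (a 2 ^ 2 * a 1) * (p 2 ^ 2 * p 1)"
      by (simp add: egf_u power2_eq_square mult_ac flip: fps_const_mult)
  qed (unfold egf_mult3, simp_all add: a_nz u_def mult_ac)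
  have TP: "P / a 1
          * (\<Sum>(k1, k2, k3)\<in>{(k1, k2, k3). k1 + k2 + k3 = m}.
              multinomial m [k1, k2, k3] * t k1 * t k2 * of_int (U n k3))
      = P * (fact m * (e2 ^ 2 * p 1) $ m)"
  proof (rule coefficient_of_scaled)
    show "egf t * egf t * egf (u 1) = fps_const (a 1) * (e2 ^ 2 * p 1)"
      by (simp add: egf_u egf_t power2_eq_square mult_ac)
  qed (unfold egf_mult3, simp_all add: a_nz u_def mult_ac)
  have TQ: "Q / (a 2 * a 1)
          * (\<Sum>(k1, k2, k3)\<in>{(k1, k2, k3). k1 + k2 + k3 = m}.
              multinomial m [k1, k2, k3] * 2 ^ k1 * of_int (U (2 * n) k1) * t k2 * of_int (U n k3))
      = Q * (fact m * (p 2 * e2 * p 1) $ m)"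
  proof (rule coefficient_of_scaled)
    show "egf (u 2) * egf t * egf (u 1) = fps_const (a 2 * a 1) * (p 2 * e2 * p 1)"
      by (simp add: egf_u egf_t mult_ac flip: fps_const_mult)
  qed (unfold egf_mult3, simp_all add: a_nz u_def mult_ac)
  have TR: "R / (a 2 * (a 1) ^ 3)
          * (\<Sum>(k1, k2, k3, k4)\<in>{(k1, k2, k3, k4). k1 + k2 + k3 + k4 = m}.
              multinomial m [k1, k2, k3, k4] * 2 ^ k1 * of_int (U (2 * n) k1) * of_int (U n k2) * of_int (U n k3) * of_int (U n k4))
      = R * (fact m * (p 2 * p 1 ^ 3) $ m)"
  proof (rule coefficient_of_scaled)
    show "egf (u 2) * egf (u 1) * egf (u 1) * egf (u 1) = fps_const (a 2 * a 1 ^ 3) * (p 2 * p 1 ^ 3)"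
      by (simp add: egf_u power3_eq_cube mult_ac flip: fps_const_mult)
  qed (unfold egf_mult4, simp_all add: a_nz u_def mult_ac)
  have TS: "S / (a 1) ^ 3
          * (\<Sum>(k1, k2, k3, k4)\<in>{(k1, k2, k3, k4). k1 + k2 + k3 + k4 = m}.
              multinomial m [k1, k2, k3, k4] * t k1 * of_int (U n k2) * of_int (U n k3) * of_int (U n k4))
      = S * (fact m * (e2 * p 1 ^ 3) $ m)"
  proof (rule coefficient_of_scaled)
    show "egf t * egf (u 1) * egf (u 1) * egf (u 1) = fps_const (a 1 ^ 3) * (e2 * p 1 ^ 3)"
      by (simp add: egf_u egf_t power3_eq_cube mult_ac flip: fps_const_mult)
  qed (unfold egf_mult4, simp_all add: a_nz u_def mult_ac)

  have fps_identity: "fps_const B * t3_gf lam n = p 1 ^ 5 - fps_const A * p 5 - fps_const E * (p 4 * p 1)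
      - fps_const F * (e4 * p 1) - fps_const G * (t2_gf lam n * p 1) - fps_const H * (p 3 * p 2)
      - fps_const I * (p 3 * e2) - fps_const J * (e3 * p 2) - fps_const K * (e3 * e2)
      - fps_const L * (p 3 * p 1 ^ 2) - fps_const M * (e3 * p 1 ^ 2) - fps_const N * (p 2 ^ 2 * p 1)
      - fps_const P * (e2 ^ 2 * p 1) - fps_const Q * (p 2 * e2 * p 1) - fps_const R * (p 2 * p 1 ^ 3)
      - fps_const S * (e2 * p 1 ^ 3)"
    by (rule quintic_expansion[OF newton(1-4) t2 t3])
      (simp_all add: A B E F H I numeral_fps_const)
  have a1: "of_rat (A1 n) = a 1" by (simp add: a_def)
  note fold_a = a1 a_def[symmetric] b_def[symmetric] t_def[symmetric]
  have "B * t3 lam n m = fact m * (fps_const B * t3_gf lam n) $ m"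
    by (simp add: t3_def)
  also have "\<dots> = 1 * (fact m * (p 1 ^ 5) $ m) - A * (fact m * p 5 $ m) - E * (fact m * (p 4 * p 1) $ m)
      - F * (fact m * (e4 * p 1) $ m) - G * (fact m * (t2_gf lam n * p 1) $ m)
      - H * (fact m * (p 3 * p 2) $ m) - I * (fact m * (p 3 * e2) $ m)
      - J * (fact m * (e3 * p 2) $ m) - K * (fact m * (e3 * e2) $ m)
      - L * (fact m * (p 3 * p 1 ^ 2) $ m) - M * (fact m * (e3 * p 1 ^ 2) $ m)
      - N * (fact m * (p 2 ^ 2 * p 1) $ m) - P * (fact m * (e2 ^ 2 * p 1) $ m)
      - Q * (fact m * (p 2 * e2 * p 1) $ m) - R * (fact m * (p 2 * p 1 ^ 3) $ m)
      - S * (fact m * (e2 * p 1 ^ 3) $ m)"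
    unfolding fps_identity fps_sub_nth fps_mult_left_const_nth right_diff_distrib
    by (simp only: mult_ac mult_1)
  finally show ?thesis
    unfolding fold_a T0 TA TE TF TG TH TI TJ TK TL TM TN TP TQ TR TS .
qed

end
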